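(* The map $a(\cdot)\mapsto\lambda_{a(\cdot)}$ is concave on $\mathcal M[\mu_0,\mu_1]$. Consequently, this map is Lipschitz with respect to the $L^\infty(\Omega;\mathbb S^n)$ norm, i.e., there is a constant $L>0$ such that $$|\lambda_{a(\cdot)}-\lambda_{\bar a(\cdot)}|\le L\,\|a(\cdot)-\bar a(\cdot)\|_{\infty}\qquad\text{for all } a(\cdot),\bar a(\cdot)\in\mathcal M[\mu_0,\mu_1].$$
   Context: $\Omega\subset\mathbb R^n$ is a fixed bounded Lipschitz domain and $0<\mu_0\le\mu_1<\infty$ are fixed constants. $\mathbb S^n$ is the set of real symmetric $n\times n$ matrices with the usual order ($A\le B$ iff $B-A$ is positive semidefinite). $M[\mu_0,\mu_1]=\{A\in\mathbb S^n: \mu_0 I\le A\le\mu_1 I\}$, and $\mathcal M[\mu_0,\mu_1]\subseteq L^\infty(\Omega;\mathbb S^n)$ is the set of all measurable $a:\Omega\to M[\mu_0,\mu_1]$. For $a(\cdot)\in\mathcal M[\mu_0,\mu_1]$, the principal eigenvalue of the operator $\varphi\mapsto-\nabla\cdot(a\nabla\varphi)$ with homogeneous Dirichlet boundary condition is $$\lambda_{a(\cdot)}=\inf_{y\in W^{1,2}_0(\Omega)\setminus\{0\}}\frac{\int_\Omega\langle a(x)\nabla y(x),\nabla y(x)\rangle\,dx}{\|y\|_{L^2(\Omega)}^2}.$$ *)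

theory Defs
  imports "HOL-Analysis.Analysis" "HOL-Probability.Essential_Supremum"
begin

text \<open>Near each boundary point, after a rotation taking the last coordinate axis to \<open>\<nu>\<close>,
  \<open>\<Omega>\<close> is the region strictly above the graph of a Lipschitz function \<open>\<gamma>\<close> on the hyperplane
  orthogonal to \<open>\<nu>\<close>.\<close>

definition lipschitz_boundary :: "(real ^ 'n) set \<Rightarrow> bool" where
  "lipschitz_boundary \<Omega> \<longleftrightarrow>
     (\<forall>p \<in> frontier \<Omega>. \<exists>r > 0. \<exists>\<nu> \<gamma> L. norm \<nu> = 1 \<and>
        L-lipschitz_on {z. z \<bullet> \<nu> = 0} \<gamma> \<and>
        \<Omega> \<inter> ball p r = {x \<in> ball p r. x \<bullet> \<nu> > \<gamma> (x - (x \<bullet> \<nu>) *\<^sub>R \<nu>)})"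

definition bounded_lipschitz_domain :: "(real ^ 'n) set \<Rightarrow> bool" where
  "bounded_lipschitz_domain \<Omega> \<longleftrightarrow>
     open \<Omega> \<and> connected \<Omega> \<and> \<Omega> \<noteq> {} \<and> bounded \<Omega> \<and> lipschitz_boundary \<Omega>"

definition classical_gradient :: "(real ^ 'n \<Rightarrow> real) \<Rightarrow> real ^ 'n \<Rightarrow> real ^ 'n" where
  "classical_gradient f x = (\<chi> i. frechet_derivative f (at x) (axis i 1))"

primrec C_k :: "nat \<Rightarrow> (real ^ 'n \<Rightarrow> real) \<Rightarrow> bool" where
  "C_k 0 f \<longleftrightarrow> continuous_on UNIV f"
| "C_k (Suc k) f \<longleftrightarrow>
     (\<forall>x. f differentiable (at x)) \<and> (\<forall>i. C_k k (\<lambda>x. classical_gradient f x $ i))"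

definition test_functions :: "(real ^ 'n) set \<Rightarrow> (real ^ 'n \<Rightarrow> real) set" where
  "test_functions \<Omega> =
     {\<phi>. (\<forall>k. C_k k \<phi>) \<and> compact (closure {x. \<phi> x \<noteq> 0}) \<and> closure {x. \<phi> x \<noteq> 0} \<subseteq> \<Omega>}"

text \<open>Elements of \<open>L\<^sup>2(\<Omega>)\<close>, \<open>W\<^sup>1\<^sup>,\<^sup>2(\<Omega>)\<close> and \<open>L\<^sup>\<infinity>(\<Omega>)\<close> are represented by functions on the whole
  space, of which only the restriction to \<open>\<Omega>\<close> modulo null sets matters.\<close>

definition L2 :: "(real ^ 'n) set \<Rightarrow> (real ^ 'n \<Rightarrow> 'b :: euclidean_space) set" where
  "L2 \<Omega> = {u \<in> borel_measurable (lebesgue_on \<Omega>).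
            integrable (lebesgue_on \<Omega>) (\<lambda>x. (norm (u x))\<^sup>2)}"

definition L2_norm :: "(real ^ 'n) set \<Rightarrow> (real ^ 'n \<Rightarrow> 'b :: euclidean_space) \<Rightarrow> real" where
  "L2_norm \<Omega> u = sqrt (\<integral>x. (norm (u x))\<^sup>2 \<partial>lebesgue_on \<Omega>)"

definition is_weak_gradient ::
  "(real ^ 'n) set \<Rightarrow> (real ^ 'n \<Rightarrow> real) \<Rightarrow> (real ^ 'n \<Rightarrow> real ^ 'n) \<Rightarrow> bool" where
  "is_weak_gradient \<Omega> u g \<longleftrightarrow> g \<in> L2 \<Omega> \<and>
     (\<forall>\<phi> \<in> test_functions \<Omega>. \<forall>i.
        (\<integral>x. u x * classical_gradient \<phi> x $ i \<partial>lebesgue_on \<Omega>) =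
        - (\<integral>x. g x $ i * \<phi> x \<partial>lebesgue_on \<Omega>))"

definition W12 :: "(real ^ 'n) set \<Rightarrow> (real ^ 'n \<Rightarrow> real) set" where
  "W12 \<Omega> = {u \<in> L2 \<Omega>. \<exists>g. is_weak_gradient \<Omega> u g}"

text \<open>A representative of the weak gradient, which is unique up to a null subset of \<open>\<Omega>\<close>.
  Only meaningful for \<open>u \<in> W12 \<Omega>\<close>.\<close>

definition weak_gradient ::
  "(real ^ 'n) set \<Rightarrow> (real ^ 'n \<Rightarrow> real) \<Rightarrow> real ^ 'n \<Rightarrow> real ^ 'n" where
  "weak_gradient \<Omega> u = (SOME g. is_weak_gradient \<Omega> u g)"

definition W12_norm :: "(real ^ 'n) set \<Rightarrow> (real ^ 'n \<Rightarrow> real) \<Rightarrow> real" where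
  "W12_norm \<Omega> u = sqrt ((L2_norm \<Omega> u)\<^sup>2 + (L2_norm \<Omega> (weak_gradient \<Omega> u))\<^sup>2)"

text \<open>The closure of the test functions in \<open>W12 \<Omega>\<close>.\<close>

definition W12_0 :: "(real ^ 'n) set \<Rightarrow> (real ^ 'n \<Rightarrow> real) set" where
  "W12_0 \<Omega> = {u \<in> W12 \<Omega>. \<exists>\<phi> :: nat \<Rightarrow> real ^ 'n \<Rightarrow> real.
     (\<forall>k. \<phi> k \<in> test_functions \<Omega>) \<and> (\<lambda>k. W12_norm \<Omega> (\<lambda>x. u x - \<phi> k x)) \<longlonglongrightarrow> 0}"

definition sym_mat :: "(real ^ 'n ^ 'n) set" where
  "sym_mat = {A. transpose A = A}"

definition pos_semidef :: "real ^ 'n ^ 'n \<Rightarrow> bool" where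
  "pos_semidef A \<longleftrightarrow> A \<in> sym_mat \<and> (\<forall>v. 0 \<le> (A *v v) \<bullet> v)"

text \<open>The Loewner order; the order \<open>\<le>\<close> that the library puts on vectors is componentwise.\<close>

definition loewner_le :: "real ^ 'n ^ 'n \<Rightarrow> real ^ 'n ^ 'n \<Rightarrow> bool" where
  "loewner_le A B \<longleftrightarrow> pos_semidef (B - A)"

definition mat_between :: "real \<Rightarrow> real \<Rightarrow> (real ^ 'n ^ 'n) set" where
  "mat_between \<mu>\<^sub>0 \<mu>\<^sub>1 =
     {A \<in> sym_mat. loewner_le (\<mu>\<^sub>0 *\<^sub>R mat 1) A \<and> loewner_le A (\<mu>\<^sub>1 *\<^sub>R mat 1)}"

text \<open>The pointwise constraint is imposed almost everywhere, so that this set is closed under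
  change of representative in \<open>L\<^sup>\<infinity>\<close>.\<close>

definition coefficients ::
  "(real ^ 'n) set \<Rightarrow> real \<Rightarrow> real \<Rightarrow> (real ^ 'n \<Rightarrow> real ^ 'n ^ 'n) set" where
  "coefficients \<Omega> \<mu>\<^sub>0 \<mu>\<^sub>1 =
     {a \<in> borel_measurable (lebesgue_on \<Omega>). AE x in lebesgue_on \<Omega>. a x \<in> mat_between \<mu>\<^sub>0 \<mu>\<^sub>1}"

text \<open>The matrix norm here is the library one, i.e. the Frobenius norm.  The conversion to
  \<open>real\<close> sends an infinite essential supremum to 0, so this is only meaningful for
  essentially bounded \<open>a\<close>.\<close>

definition Linf_norm :: "(real ^ 'n) set \<Rightarrow> (real ^ 'n \<Rightarrow> real ^ 'n ^ 'n) \<Rightarrow> real" where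
  "Linf_norm \<Omega> a = real_of_ereal (esssup (lebesgue_on \<Omega>) (\<lambda>x. ereal (norm (a x))))"

definition principal_eigenvalue ::
  "(real ^ 'n) set \<Rightarrow> (real ^ 'n \<Rightarrow> real ^ 'n ^ 'n) \<Rightarrow> real" where
  "principal_eigenvalue \<Omega> a =
     (INF y \<in> {y \<in> W12_0 \<Omega>. \<not> (AE x in lebesgue_on \<Omega>. y x = 0)}.
        (\<integral>x. (a x *v weak_gradient \<Omega> y x) \<bullet> weak_gradient \<Omega> y x \<partial>lebesgue_on \<Omega>)
          / (L2_norm \<Omega> y)\<^sup>2)"

end

theory Submission
  imports Defs
begin

text \<open>
  For a fixed function \<open>y\<close> the Rayleigh quotient of \<open>y\<close> is an affine function of the
  coefficient \<open>a\<close>, and \<open>\<lambda>\<^sub>a\<close> is the infimum of these quotients over all admissible \<open>y\<close>.  An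
  infimum of affine functions is concave (\<open>principal_eigenvalue_concave\<close>).

  For the Lipschitz estimate, let \<open>D y\<close> be the Rayleigh quotient of \<open>y\<close> for the Laplacian, so
  that ellipticity says that the quotient \<open>R\<^sub>a y\<close> lies between \<open>\<mu>\<^sub>0 * D y\<close> and \<open>\<mu>\<^sub>1 * D y\<close>.
  Writing \<open>\<delta>\<close> for the sup norm of \<open>a - b\<close>, one has
  \<open>R\<^sub>a y \<le> R\<^sub>b y + \<delta> * D y \<le> (1 + \<delta> / \<mu>\<^sub>0) * R\<^sub>b y\<close>.  The error term has
  to be absorbed in \<open>R\<^sub>b y\<close> because \<open>D y\<close> has no bound that is uniform in \<open>y\<close>.  Taking infima
  gives \<open>\<lambda>\<^sub>a \<le> \<lambda>\<^sub>b + (\<delta> / \<mu>\<^sub>0) * \<lambda>\<^sub>b\<close>, and testing with a single admissible \<open>y\<^sub>0\<close> bounds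
  the factor \<open>\<lambda>\<^sub>b\<close> by \<open>\<mu>\<^sub>1 * D y\<^sub>0\<close> uniformly in \<open>b\<close> (\<open>principal_eigenvalue_perturb\<close>).
  Exchanging \<open>a\<close> and \<open>b\<close> gives the Lipschitz bound.  Both infima run over the same functions \<open>y\<close>,
  because the admissible set does not involve the coefficient.
\<close>

section \<open>Uniformly elliptic matrices\<close>

lemma norm_matrix_vector_mult_le:
  fixes A :: "real ^ 'n ^ 'm"
  shows "norm (A *v v) \<le> norm A * norm v"
proof -
  have "norm (A *v v) = L2_set (\<lambda>i. \<bar>A $ i \<bullet> v\<bar>) UNIV"
    by (simp add: norm_vec_def matrix_vector_mul_component)
  also have "\<dots> \<le> L2_set (\<lambda>i. norm (A $ i) * norm v) UNIV"
    by (intro L2_set_mono) (auto simp: Cauchy_Schwarz_ineq2)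
  also have "\<dots> = norm A * norm v"
    by (simp add: norm_vec_def[of A] L2_set_left_distrib)
  finally show ?thesis .
qed

lemma quadratic_form_le_norm:
  fixes A :: "real ^ 'n ^ 'n"
  shows "(A *v v) \<bullet> v \<le> norm A * (norm v)\<^sup>2"
proof -
  have "(A *v v) \<bullet> v \<le> norm (A *v v) * norm v"
    by (rule norm_cauchy_schwarz)
  also have "\<dots> \<le> (norm A * norm v) * norm v"
    by (intro mult_right_mono norm_matrix_vector_mult_le) auto
  finally show ?thesis
    by (simp add: power2_eq_square mult.assoc)
qed

lemma mat_between_iff:
  fixes A :: "real ^ 'n ^ 'n"
  shows "A \<in> mat_between \<mu>\<^sub>0 \<mu>\<^sub>1 \<longleftrightarrow> transpose A = A \<and>
     (\<forall>v. \<mu>\<^sub>0 * (norm v)\<^sup>2 \<le> (A *v v) \<bullet> v \<and> (A *v v) \<bullet> v \<le> \<mu>\<^sub>1 * (norm v)\<^sup>2)"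
proof -
  have "transpose (c *\<^sub>R mat 1 :: real ^ 'n ^ 'n) = c *\<^sub>R mat 1" for c
    by (simp add: transpose_def mat_def vec_eq_iff)
  moreover have "transpose (B - C) = transpose B - transpose C" for B C :: "real ^ 'n ^ 'n"
    by (simp add: transpose_def vec_eq_iff)
  moreover have "(c *\<^sub>R mat 1 :: real ^ 'n ^ 'n) *v v = c *\<^sub>R v" for c v
    by (simp add: scaleR_matrix_vector_assoc[symmetric])
  ultimately show ?thesis
    by (auto simp: mat_between_def loewner_le_def pos_semidef_def sym_mat_def
        matrix_vector_mult_diff_rdistrib inner_diff_left power2_norm_eq_inner)
qed

lemma quadratic_form_combination:
  fixes A B :: "real ^ 'n ^ 'n"
  shows "((s *\<^sub>R A + t *\<^sub>R B) *v v) \<bullet> v = s * ((A *v v) \<bullet> v) + t * ((B *v v) \<bullet> v)"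
  by (simp add: matrix_vector_mult_add_rdistrib inner_add_left
      scaleR_matrix_vector_assoc[symmetric])

lemma mat_between_convex: "convex (mat_between \<mu>\<^sub>0 \<mu>\<^sub>1)"
proof (rule convexI)
  fix A B :: "real ^ 'n ^ 'n" and s t :: real
  assume A: "A \<in> mat_between \<mu>\<^sub>0 \<mu>\<^sub>1" and B: "B \<in> mat_between \<mu>\<^sub>0 \<mu>\<^sub>1"
    and st: "0 \<le> s" "0 \<le> t" "s + t = 1"
  have "transpose (s *\<^sub>R A + t *\<^sub>R B) = s *\<^sub>R transpose A + t *\<^sub>R transpose B"
    by (simp add: transpose_def vec_eq_iff)
  moreover have "s * c + t * c = c" for c :: real
    using st by (simp add: distrib_right[symmetric])
  then have "\<mu>\<^sub>0 * (norm v)\<^sup>2 \<le> s * ((A *v v) \<bullet> v) + t * ((B *v v) \<bullet> v)"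
    and "s * ((A *v v) \<bullet> v) + t * ((B *v v) \<bullet> v) \<le> \<mu>\<^sub>1 * (norm v)\<^sup>2" for v
    using A B st by (metis add_mono mat_between_iff mult_left_mono)+
  ultimately show "s *\<^sub>R A + t *\<^sub>R B \<in> mat_between \<mu>\<^sub>0 \<mu>\<^sub>1"
    using A B by (simp add: mat_between_iff quadratic_form_combination)
qed

text \<open>Bounding the quadratic form on the vectors \<open>e\<^sub>i + e\<^sub>j\<close>, \<open>e\<^sub>i\<close> and \<open>e\<^sub>j\<close> bounds the entry
  \<open>A\<^sub>i\<^sub>j\<close> of a symmetric matrix, by polarization.  The order bounds therefore give an
  entrywise, hence a Frobenius norm bound.\<close>

lemma mat_between_norm_le:
  fixes A :: "real ^ 'n ^ 'n"
  assumes A: "A \<in> mat_between \<mu>\<^sub>0 \<mu>\<^sub>1" and \<mu>: "0 \<le> \<mu>\<^sub>0" "\<mu>\<^sub>0 \<le> \<mu>\<^sub>1"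
  shows "norm A \<le> real CARD('n) * (real CARD('n) * (2 * \<mu>\<^sub>1))"
proof -
  have entry: "\<bar>A $ i $ j\<bar> \<le> 2 * \<mu>\<^sub>1" for i j
  proof -
    let ?q = "\<lambda>v. (A *v v) \<bullet> v"
    let ?e = "\<lambda>i. axis i 1 :: real ^ 'n"
    have q: "0 \<le> ?q v" "?q v \<le> \<mu>\<^sub>1 * (norm v)\<^sup>2" for v
      using A \<mu> order_trans[of 0 "\<mu>\<^sub>0 * (norm v)\<^sup>2" "?q v"] by (auto simp: mat_between_iff)
    have Aij: "(A *v ?e j) \<bullet> ?e i = A $ i $ j" for i j
      by (simp add: matrix_vector_mult_basis inner_axis column_def)
    have sym: "A $ j $ i = A $ i $ j"
      using A by (auto simp: mat_between_iff transpose_def vec_eq_iff)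
    have pol: "?q (?e i + ?e j) = ?q (?e i) + ?q (?e j) + 2 * A $ i $ j"
      using sym by (simp add: matrix_vector_right_distrib inner_add_left inner_add_right Aij)
    have "(norm (?e i + ?e j))\<^sup>2 \<le> (1 + 1)\<^sup>2"
      by (intro power_mono norm_triangle_le) auto
    then have "\<mu>\<^sub>1 * (norm (?e i + ?e j))\<^sup>2 \<le> \<mu>\<^sub>1 * 4"
      using \<mu> by (intro mult_left_mono) auto
    then have "?q (?e i + ?e j) \<le> \<mu>\<^sub>1 * 4"
      using q(2)[of "?e i + ?e j"] by linarith
    moreover have "?q (?e i) \<le> \<mu>\<^sub>1" "?q (?e j) \<le> \<mu>\<^sub>1"
      using q(2)[of "?e i"] q(2)[of "?e j"] by simp_all
    ultimately show ?thesis
      using pol q(1)[of "?e i"] q(1)[of "?e j"] q(1)[of "?e i + ?e j"] by linarith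
  qed
  have "norm A \<le> (\<Sum>i\<in>UNIV. norm (A $ i))"
    unfolding norm_vec_def[of A] by (rule L2_set_le_sum) auto
  also have "\<dots> \<le> (\<Sum>i\<in>(UNIV :: 'n set). real CARD('n) * (2 * \<mu>\<^sub>1))"
  proof (rule sum_mono)
    fix i
    have "norm (A $ i) \<le> (\<Sum>j\<in>UNIV. \<bar>A $ i $ j\<bar>)"
      by (rule norm_le_l1_cart)
    also have "\<dots> \<le> (\<Sum>j\<in>(UNIV :: 'n set). 2 * \<mu>\<^sub>1)"
      by (intro sum_mono entry)
    finally show "norm (A $ i) \<le> real CARD('n) * (2 * \<mu>\<^sub>1)"
      by simp
  qed
  finally show ?thesis
    by simp
qed

section \<open>Coefficients and their distance\<close>

lemma coefficients_convex:
  assumes "a \<in> coefficients \<Omega> \<mu>\<^sub>0 \<mu>\<^sub>1" and "b \<in> coefficients \<Omega> \<mu>\<^sub>0 \<mu>\<^sub>1" and "t \<in> {0..1}"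
  shows "(\<lambda>x. (1 - t) *\<^sub>R a x + t *\<^sub>R b x) \<in> coefficients \<Omega> \<mu>\<^sub>0 \<mu>\<^sub>1"
proof -
  have [measurable]: "a \<in> borel_measurable (lebesgue_on \<Omega>)" "b \<in> borel_measurable (lebesgue_on \<Omega>)"
    using assms by (auto simp: coefficients_def)
  have "AE x in lebesgue_on \<Omega>. a x \<in> mat_between \<mu>\<^sub>0 \<mu>\<^sub>1"
    "AE x in lebesgue_on \<Omega>. b x \<in> mat_between \<mu>\<^sub>0 \<mu>\<^sub>1"
    using assms by (auto simp: coefficients_def)
  then have "AE x in lebesgue_on \<Omega>. (1 - t) *\<^sub>R a x + t *\<^sub>R b x \<in> mat_between \<mu>\<^sub>0 \<mu>\<^sub>1"
    by eventually_elim (use assms(3) in \<open>auto intro!: convexD[OF mat_between_convex]\<close>)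
  then show ?thesis
    by (simp add: coefficients_def)
qed

text \<open>The essential supremum is \<open>-\<infinity>\<close> on a null set and \<open>\<infinity>\<close> for a non-measurable
  function; both are converted to \<open>0\<close>.\<close>

lemma Linf_norm_nonneg: "0 \<le> Linf_norm \<Omega> f"
proof -
  let ?M = "lebesgue_on \<Omega>" and ?f = "\<lambda>x. ereal (norm (f x))"
  consider "?f \<notin> borel_measurable ?M"
    | "?f \<in> borel_measurable ?M" "emeasure ?M (space ?M) = 0"
    | "emeasure ?M (space ?M) \<noteq> 0"
    by blast
  then show ?thesis
  proof cases
    case 1
    then show ?thesis
      by (simp add: Linf_norm_def esssup_non_measurable top_ereal_def)
  next
    case 2
    then show ?thesis
      by (simp add: Linf_norm_def esssup_zero_space)
  next
    case 3
    then have "0 = esssup ?M (\<lambda>x. 0 :: ereal)"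
      by (simp add: esssup_const)
    also have "\<dots> \<le> esssup ?M ?f"
      by (intro esssup_mono) auto
    finally show ?thesis
      by (simp add: Linf_norm_def real_of_ereal_pos)
  qed
qed

text \<open>Since both coefficients are essentially bounded, the essential supremum of their distance
  is finite, so its conversion to a real number does not fall to the default \<open>0\<close> and stays an almost
  everywhere bound.\<close>

lemma AE_norm_diff_le_Linf_norm:
  fixes a b :: "real ^ 'n \<Rightarrow> real ^ 'n ^ 'n"
  assumes a: "a \<in> coefficients \<Omega> \<mu>\<^sub>0 \<mu>\<^sub>1" and b: "b \<in> coefficients \<Omega> \<mu>\<^sub>0 \<mu>\<^sub>1"
    and \<mu>: "0 \<le> \<mu>\<^sub>0" "\<mu>\<^sub>0 \<le> \<mu>\<^sub>1"
  shows "AE x in lebesgue_on \<Omega>. norm (a x - b x) \<le> Linf_norm \<Omega> (\<lambda>x. a x - b x)"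
proof -
  let ?M = "lebesgue_on \<Omega>" and ?f = "\<lambda>x. ereal (norm (a x - b x))"
  define C where "C = real CARD('n) * (real CARD('n) * (2 * \<mu>\<^sub>1))"
  have [measurable]: "a \<in> borel_measurable ?M" "b \<in> borel_measurable ?M"
    using a b by (auto simp: coefficients_def)
  have "AE x in ?M. a x \<in> mat_between \<mu>\<^sub>0 \<mu>\<^sub>1" "AE x in ?M. b x \<in> mat_between \<mu>\<^sub>0 \<mu>\<^sub>1"
    using a b by (auto simp: coefficients_def)
  then have "AE x in ?M. ?f x \<le> ereal (C + C)"
  proof eventually_elim
    case (elim x)
    then have "norm (a x) \<le> C" "norm (b x) \<le> C"
      unfolding C_def using \<mu> by (auto intro: mat_between_norm_le)
    then show ?case
      using norm_triangle_ineq4[of "a x" "b x"] by simp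
  qed
  then have "esssup ?M ?f \<le> ereal (C + C)"
    by (intro esssup_I) auto
  then have finite: "esssup ?M ?f \<noteq> \<infinity>"
    by auto
  have "AE x in ?M. ?f x \<le> esssup ?M ?f"
    by (rule esssup_AE)
  then show ?thesis
  proof eventually_elim
    case (elim x)
    then show ?case
      using finite unfolding Linf_norm_def by (cases "esssup ?M ?f") auto
  qed
qed

section \<open>Rayleigh quotients\<close>

definition admissible :: "(real ^ 'n) set \<Rightarrow> (real ^ 'n \<Rightarrow> real) set" where
  "admissible \<Omega> = {y \<in> W12_0 \<Omega>. \<not> (AE x in lebesgue_on \<Omega>. y x = 0)}"

definition rayleigh_quotient ::
  "(real ^ 'n) set \<Rightarrow> (real ^ 'n \<Rightarrow> real ^ 'n ^ 'n) \<Rightarrow> (real ^ 'n \<Rightarrow> real) \<Rightarrow> real" where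
  "rayleigh_quotient \<Omega> a y =
     (\<integral>x. (a x *v weak_gradient \<Omega> y x) \<bullet> weak_gradient \<Omega> y x \<partial>lebesgue_on \<Omega>)
       / (L2_norm \<Omega> y)\<^sup>2"

text \<open>The case of the identity coefficient, against which ellipticity compares all others.\<close>

definition laplace_quotient :: "(real ^ 'n) set \<Rightarrow> (real ^ 'n \<Rightarrow> real) \<Rightarrow> real" where
  "laplace_quotient \<Omega> y =
     (\<integral>x. (norm (weak_gradient \<Omega> y x))\<^sup>2 \<partial>lebesgue_on \<Omega>) / (L2_norm \<Omega> y)\<^sup>2"

lemma principal_eigenvalue_eq_INF:
  "principal_eigenvalue \<Omega> a = (INF y \<in> admissible \<Omega>. rayleigh_quotient \<Omega> a y)"
  by (simp add: principal_eigenvalue_def admissible_def rayleigh_quotient_def)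

lemma weak_gradient_in_L2:
  assumes "y \<in> W12 \<Omega>"
  shows "weak_gradient \<Omega> y \<in> L2 \<Omega>"
proof -
  obtain g where "is_weak_gradient \<Omega> y g"
    using assms by (auto simp: W12_def)
  then have "is_weak_gradient \<Omega> y (weak_gradient \<Omega> y)"
    unfolding weak_gradient_def by (rule someI[of "is_weak_gradient \<Omega> y"])
  then show ?thesis
    by (simp add: is_weak_gradient_def)
qed

lemma admissible_weak_gradient:
  assumes "y \<in> admissible \<Omega>"
  shows "weak_gradient \<Omega> y \<in> L2 \<Omega>"
  using assms weak_gradient_in_L2 by (auto simp: admissible_def W12_0_def)

lemma measurable_quadratic_form:
  fixes a :: "'a \<Rightarrow> real ^ 'n ^ 'n" and g :: "'a \<Rightarrow> real ^ 'n"
  assumes [measurable]: "a \<in> borel_measurable M" "g \<in> borel_measurable M"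
  shows "(\<lambda>x. (a x *v g x) \<bullet> g x) \<in> borel_measurable M"
proof -
  have "continuous_on UNIV (\<lambda>p :: (real ^ 'n ^ 'n) \<times> (real ^ 'n). (fst p *v snd p) \<bullet> snd p)"
    unfolding matrix_vector_mult_def by (intro continuous_intros)
  from borel_measurable_continuous_Pair[OF assms this] show ?thesis
    by simp
qed

lemma integrable_quadratic_form:
  assumes a: "a \<in> coefficients \<Omega> \<mu>\<^sub>0 \<mu>\<^sub>1" and \<mu>: "0 \<le> \<mu>\<^sub>0" and g: "g \<in> L2 \<Omega>"
  shows "integrable (lebesgue_on \<Omega>) (\<lambda>x. (a x *v g x) \<bullet> g x)"
proof (rule Bochner_Integration.integrable_bound)
  show "integrable (lebesgue_on \<Omega>) (\<lambda>x. \<mu>\<^sub>1 * (norm (g x))\<^sup>2)"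
    using g by (simp add: L2_def)
  show "(\<lambda>x. (a x *v g x) \<bullet> g x) \<in> borel_measurable (lebesgue_on \<Omega>)"
    using a g by (intro measurable_quadratic_form) (auto simp: coefficients_def L2_def)
  have "AE x in lebesgue_on \<Omega>. a x \<in> mat_between \<mu>\<^sub>0 \<mu>\<^sub>1"
    using a by (simp add: coefficients_def)
  then show "AE x in lebesgue_on \<Omega>. norm ((a x *v g x) \<bullet> g x) \<le> norm (\<mu>\<^sub>1 * (norm (g x))\<^sup>2)"
  proof eventually_elim
    case (elim x)
    moreover have "0 \<le> \<mu>\<^sub>0 * (norm (g x))\<^sup>2"
      using \<mu> by simp
    ultimately have "0 \<le> (a x *v g x) \<bullet> g x" "(a x *v g x) \<bullet> g x \<le> \<mu>\<^sub>1 * (norm (g x))\<^sup>2"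
      by (auto simp: mat_between_iff intro: order_trans)
    then show ?case
      by simp
  qed
qed

text \<open>The weak gradient of \<open>y\<close> is the same for all coefficients, so only linearity of the
  integral is at stake; the integrability of both energies makes it available.\<close>

lemma rayleigh_quotient_affine:
  assumes a: "a \<in> coefficients \<Omega> \<mu>\<^sub>0 \<mu>\<^sub>1" and b: "b \<in> coefficients \<Omega> \<mu>\<^sub>0 \<mu>\<^sub>1"
    and \<mu>: "0 \<le> \<mu>\<^sub>0" and y: "y \<in> admissible \<Omega>"
  shows "rayleigh_quotient \<Omega> (\<lambda>x. s *\<^sub>R a x + t *\<^sub>R b x) y =
    s * rayleigh_quotient \<Omega> a y + t * rayleigh_quotient \<Omega> b y"
  using integrable_quadratic_form[OF a \<mu> admissible_weak_gradient[OF y]]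
    integrable_quadratic_form[OF b \<mu> admissible_weak_gradient[OF y]]
  by (simp add: rayleigh_quotient_def quadratic_form_combination add_divide_distrib)

lemma laplace_quotient_nonneg: "0 \<le> laplace_quotient \<Omega> y"
  by (simp add: laplace_quotient_def)

lemma rayleigh_quotient_bounds:
  assumes a: "a \<in> coefficients \<Omega> \<mu>\<^sub>0 \<mu>\<^sub>1" and \<mu>: "0 \<le> \<mu>\<^sub>0" and y: "y \<in> admissible \<Omega>"
  shows "\<mu>\<^sub>0 * laplace_quotient \<Omega> y \<le> rayleigh_quotient \<Omega> a y"
    and "rayleigh_quotient \<Omega> a y \<le> \<mu>\<^sub>1 * laplace_quotient \<Omega> y"
proof -
  let ?M = "lebesgue_on \<Omega>" and ?g = "weak_gradient \<Omega> y"
  have g: "?g \<in> L2 \<Omega>"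
    using y by (rule admissible_weak_gradient)
  have int: "integrable ?M (\<lambda>x. c * (norm (?g x))\<^sup>2)" for c
    using g by (simp add: L2_def)
  note int_a = integrable_quadratic_form[OF a \<mu> g]
  have ae: "AE x in ?M. a x \<in> mat_between \<mu>\<^sub>0 \<mu>\<^sub>1"
    using a by (simp add: coefficients_def)
  have "(\<integral>x. \<mu>\<^sub>0 * (norm (?g x))\<^sup>2 \<partial>?M) \<le> (\<integral>x. (a x *v ?g x) \<bullet> ?g x \<partial>?M)"
    using ae by (intro integral_mono_AE int int_a) (auto simp: mat_between_iff)
  then show "\<mu>\<^sub>0 * laplace_quotient \<Omega> y \<le> rayleigh_quotient \<Omega> a y"
    by (simp add: laplace_quotient_def rayleigh_quotient_def divide_right_mono)
  have "(\<integral>x. (a x *v ?g x) \<bullet> ?g x \<partial>?M) \<le> (\<integral>x. \<mu>\<^sub>1 * (norm (?g x))\<^sup>2 \<partial>?M)"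
    using ae by (intro integral_mono_AE int int_a) (auto simp: mat_between_iff)
  then show "rayleigh_quotient \<Omega> a y \<le> \<mu>\<^sub>1 * laplace_quotient \<Omega> y"
    by (simp add: laplace_quotient_def rayleigh_quotient_def divide_right_mono)
qed

text \<open>The Frobenius norm dominates the operator norm, so the energy densities of \<open>a\<close> and \<open>b\<close>
  differ at almost every point by at most the sup distance times the squared gradient.\<close>

lemma rayleigh_quotient_perturb:
  assumes a: "a \<in> coefficients \<Omega> \<mu>\<^sub>0 \<mu>\<^sub>1" and b: "b \<in> coefficients \<Omega> \<mu>\<^sub>0 \<mu>\<^sub>1"
    and \<mu>: "0 \<le> \<mu>\<^sub>0" "\<mu>\<^sub>0 \<le> \<mu>\<^sub>1" and y: "y \<in> admissible \<Omega>"
  shows "rayleigh_quotient \<Omega> a y \<le>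
    rayleigh_quotient \<Omega> b y + Linf_norm \<Omega> (\<lambda>x. a x - b x) * laplace_quotient \<Omega> y"
proof -
  let ?M = "lebesgue_on \<Omega>" and ?g = "weak_gradient \<Omega> y"
  let ?\<delta> = "Linf_norm \<Omega> (\<lambda>x. a x - b x)"
  have g: "?g \<in> L2 \<Omega>"
    using y by (rule admissible_weak_gradient)
  then have int: "integrable ?M (\<lambda>x. ?\<delta> * (norm (?g x))\<^sup>2)"
    by (simp add: L2_def)
  note int_a = integrable_quadratic_form[OF a \<mu>(1) g]
    and int_b = integrable_quadratic_form[OF b \<mu>(1) g]
  have "AE x in ?M. (a x *v ?g x) \<bullet> ?g x \<le> (b x *v ?g x) \<bullet> ?g x + ?\<delta> * (norm (?g x))\<^sup>2"
    using AE_norm_diff_le_Linf_norm[OF a b \<mu>]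
  proof eventually_elim
    case (elim x)
    have "(a x *v ?g x) \<bullet> ?g x - (b x *v ?g x) \<bullet> ?g x \<le> norm (a x - b x) * (norm (?g x))\<^sup>2"
      using quadratic_form_le_norm[of "a x - b x" "?g x"]
      by (simp add: matrix_vector_mult_diff_rdistrib inner_diff_left)
    also have "\<dots> \<le> ?\<delta> * (norm (?g x))\<^sup>2"
      using elim by (intro mult_right_mono) auto
    finally show ?case
      by simp
  qed
  then have "(\<integral>x. (a x *v ?g x) \<bullet> ?g x \<partial>?M)
      \<le> (\<integral>x. (b x *v ?g x) \<bullet> ?g x + ?\<delta> * (norm (?g x))\<^sup>2 \<partial>?M)"
    using int int_a int_b by (intro integral_mono_AE) auto
  also have "\<dots> = (\<integral>x. (b x *v ?g x) \<bullet> ?g x \<partial>?M) + ?\<delta> * (\<integral>x. (norm (?g x))\<^sup>2 \<partial>?M)"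
    using int int_b by simp
  finally have "(\<integral>x. (a x *v ?g x) \<bullet> ?g x \<partial>?M) / (L2_norm \<Omega> y)\<^sup>2 \<le>
      ((\<integral>x. (b x *v ?g x) \<bullet> ?g x \<partial>?M) + ?\<delta> * (\<integral>x. (norm (?g x))\<^sup>2 \<partial>?M)) / (L2_norm \<Omega> y)\<^sup>2"
    by (intro divide_right_mono) auto
  then show ?thesis
    by (simp add: rayleigh_quotient_def laplace_quotient_def add_divide_distrib)
qed

section \<open>The principal eigenvalue as a function of the coefficient\<close>

lemma principal_eigenvalue_le:
  assumes a: "a \<in> coefficients \<Omega> \<mu>\<^sub>0 \<mu>\<^sub>1" and \<mu>: "0 \<le> \<mu>\<^sub>0" and y: "y \<in> admissible \<Omega>"
  shows "principal_eigenvalue \<Omega> a \<le> rayleigh_quotient \<Omega> a y"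
  unfolding principal_eigenvalue_eq_INF
proof (rule cINF_lower[OF _ y])
  show "bdd_below (rayleigh_quotient \<Omega> a ` admissible \<Omega>)"
  proof (rule bdd_belowI2)
    fix z assume z: "z \<in> admissible \<Omega>"
    have "0 \<le> \<mu>\<^sub>0 * laplace_quotient \<Omega> z"
      using \<mu> laplace_quotient_nonneg[of \<Omega> z] by simp
    also have "\<dots> \<le> rayleigh_quotient \<Omega> a z"
      using a \<mu> z by (rule rayleigh_quotient_bounds)
    finally show "0 \<le> rayleigh_quotient \<Omega> a z" .
  qed
qed

lemma principal_eigenvalue_greatest:
  assumes "admissible \<Omega> \<noteq> {}"
    and "\<And>y. y \<in> admissible \<Omega> \<Longrightarrow> m \<le> rayleigh_quotient \<Omega> a y"
  shows "m \<le> principal_eigenvalue \<Omega> a"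
  unfolding principal_eigenvalue_eq_INF using assms by (rule cINF_greatest)

lemma principal_eigenvalue_concave:
  assumes a: "a \<in> coefficients \<Omega> \<mu>\<^sub>0 \<mu>\<^sub>1" and b: "b \<in> coefficients \<Omega> \<mu>\<^sub>0 \<mu>\<^sub>1"
    and \<mu>: "0 \<le> \<mu>\<^sub>0" and t: "t \<in> {0..1}"
  shows "(1 - t) * principal_eigenvalue \<Omega> a + t * principal_eigenvalue \<Omega> b
    \<le> principal_eigenvalue \<Omega> (\<lambda>x. (1 - t) *\<^sub>R a x + t *\<^sub>R b x)"
proof (cases "admissible \<Omega> = {}")
  case True
  \<comment> \<open>The infimum over the empty set does not depend on the coefficient.\<close>
  then show ?thesis
    by (simp add: principal_eigenvalue_eq_INF algebra_simps)
next
  case False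
  then show ?thesis
  proof (rule principal_eigenvalue_greatest)
    fix y assume y: "y \<in> admissible \<Omega>"
    have "(1 - t) * principal_eigenvalue \<Omega> a + t * principal_eigenvalue \<Omega> b
        \<le> (1 - t) * rayleigh_quotient \<Omega> a y + t * rayleigh_quotient \<Omega> b y"
      using t principal_eigenvalue_le[OF a \<mu> y] principal_eigenvalue_le[OF b \<mu> y]
      by (intro add_mono mult_left_mono) auto
    also have "\<dots> = rayleigh_quotient \<Omega> (\<lambda>x. (1 - t) *\<^sub>R a x + t *\<^sub>R b x) y"
      using rayleigh_quotient_affine[OF a b \<mu> y] by simp
    finally show "(1 - t) * principal_eigenvalue \<Omega> a + t * principal_eigenvalue \<Omega> b
        \<le> rayleigh_quotient \<Omega> (\<lambda>x. (1 - t) *\<^sub>R a x + t *\<^sub>R b x) y" .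
  qed
qed

text \<open>The additive error in the quotient of \<open>y\<close> is turned into the factor \<open>k\<close>, which is independent
  of \<open>y\<close> and so passes through the infimum.  The bound of \<open>\<lambda>\<^sub>b\<close> by the single quotient of \<open>y\<^sub>0\<close>
  then turns the relative error back into an absolute one.\<close>

lemma principal_eigenvalue_perturb:
  assumes a: "a \<in> coefficients \<Omega> \<mu>\<^sub>0 \<mu>\<^sub>1" and b: "b \<in> coefficients \<Omega> \<mu>\<^sub>0 \<mu>\<^sub>1"
    and \<mu>: "0 < \<mu>\<^sub>0" "\<mu>\<^sub>0 \<le> \<mu>\<^sub>1" and y\<^sub>0: "y\<^sub>0 \<in> admissible \<Omega>"
  shows "principal_eigenvalue \<Omega> a - principal_eigenvalue \<Omega> b
    \<le> \<mu>\<^sub>1 * laplace_quotient \<Omega> y\<^sub>0 / \<mu>\<^sub>0 * Linf_norm \<Omega> (\<lambda>x. a x - b x)"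
proof -
  let ?\<delta> = "Linf_norm \<Omega> (\<lambda>x. a x - b x)"
  let ?\<Lambda> = "principal_eigenvalue \<Omega>" and ?R = "rayleigh_quotient \<Omega>"
  let ?D = "laplace_quotient \<Omega>"
  define k where "k = 1 + ?\<delta> / \<mu>\<^sub>0"
  have \<delta>: "0 \<le> ?\<delta>"
    by (rule Linf_norm_nonneg)
  then have k: "0 < k"
    using \<mu> by (auto simp: k_def intro: add_pos_nonneg)
  have \<mu>0: "0 \<le> \<mu>\<^sub>0"
    using \<mu> by simp
  have "?\<Lambda> a / k \<le> ?\<Lambda> b"
  proof (rule principal_eigenvalue_greatest)
    fix y assume y: "y \<in> admissible \<Omega>"
    have "?D y \<le> ?R b y / \<mu>\<^sub>0"
      using rayleigh_quotient_bounds(1)[OF b \<mu>0 y] \<mu> by (simp add: field_simps)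
    then have "?\<delta> * ?D y \<le> ?\<delta> * (?R b y / \<mu>\<^sub>0)"
      using \<delta> by (rule mult_left_mono)
    then have "?\<Lambda> a \<le> ?R b y + ?\<delta> * (?R b y / \<mu>\<^sub>0)"
      using principal_eigenvalue_le[OF a \<mu>0 y] rayleigh_quotient_perturb[OF a b \<mu>0 \<mu>(2) y]
      by linarith
    also have "\<dots> = ?R b y * k"
      by (simp add: k_def distrib_left mult.commute)
    finally show "?\<Lambda> a / k \<le> ?R b y"
      using k by (simp add: pos_divide_le_eq)
  qed (use y\<^sub>0 in auto)
  then have "?\<Lambda> a \<le> ?\<Lambda> b * k"
    using k by (simp add: pos_divide_le_eq)
  then have "?\<Lambda> a - ?\<Lambda> b \<le> ?\<Lambda> b * (?\<delta> / \<mu>\<^sub>0)"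
    by (simp add: k_def distrib_left)
  also have "\<dots> \<le> (\<mu>\<^sub>1 * ?D y\<^sub>0) * (?\<delta> / \<mu>\<^sub>0)"
  proof (rule mult_right_mono)
    show "?\<Lambda> b \<le> \<mu>\<^sub>1 * ?D y\<^sub>0"
      using principal_eigenvalue_le[OF b \<mu>0 y\<^sub>0] rayleigh_quotient_bounds(2)[OF b \<mu>0 y\<^sub>0]
      by (rule order_trans)
  qed (use \<delta> \<mu> in auto)
  finally show ?thesis
    by simp
qed

lemma Linf_norm_diff_commute:
  "Linf_norm \<Omega> (\<lambda>x. a x - b x) = Linf_norm \<Omega> (\<lambda>x. b x - a x)"
  by (simp add: Linf_norm_def norm_minus_commute)

lemma principal_eigenvalue_Lipschitz:
  assumes \<mu>: "0 < \<mu>\<^sub>0" "\<mu>\<^sub>0 \<le> \<mu>\<^sub>1"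
  shows "\<exists>L > 0. \<forall>a \<in> coefficients \<Omega> \<mu>\<^sub>0 \<mu>\<^sub>1. \<forall>b \<in> coefficients \<Omega> \<mu>\<^sub>0 \<mu>\<^sub>1.
    \<bar>principal_eigenvalue \<Omega> a - principal_eigenvalue \<Omega> b\<bar>
      \<le> L * Linf_norm \<Omega> (\<lambda>x. a x - b x)"
proof (cases "admissible \<Omega> = {}")
  case True
  \<comment> \<open>Here the eigenvalue is one and the same default number for all coefficients.\<close>
  then show ?thesis
    by (auto simp: principal_eigenvalue_eq_INF Linf_norm_nonneg intro!: exI[of _ 1])
next
  case False
  then obtain y\<^sub>0 where y\<^sub>0: "y\<^sub>0 \<in> admissible \<Omega>"
    by blast
  define K where "K = \<mu>\<^sub>1 * laplace_quotient \<Omega> y\<^sub>0 / \<mu>\<^sub>0"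
  have "0 \<le> K"
    using \<mu> laplace_quotient_nonneg[of \<Omega> y\<^sub>0] by (simp add: K_def)
  \<comment> \<open>\<open>K\<close> vanishes if the gradient of \<open>y\<^sub>0\<close> does; adding \<open>1\<close> makes the constant positive.\<close>
  show ?thesis
  proof (intro exI[of _ "K + 1"] conjI ballI)
    show "0 < K + 1"
      using \<open>0 \<le> K\<close> by simp
  next
    fix a b
    assume a: "a \<in> coefficients \<Omega> \<mu>\<^sub>0 \<mu>\<^sub>1" and b: "b \<in> coefficients \<Omega> \<mu>\<^sub>0 \<mu>\<^sub>1"
    let ?\<delta> = "Linf_norm \<Omega> (\<lambda>x. a x - b x)"
    have "\<bar>principal_eigenvalue \<Omega> a - principal_eigenvalue \<Omega> b\<bar> \<le> K * ?\<delta>"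
      using principal_eigenvalue_perturb[OF a b \<mu> y\<^sub>0] principal_eigenvalue_perturb[OF b a \<mu> y\<^sub>0]
      unfolding K_def Linf_norm_diff_commute[of \<Omega> b a] by linarith
    also have "\<dots> \<le> (K + 1) * ?\<delta>"
      by (intro mult_right_mono Linf_norm_nonneg) simp
    finally show "\<bar>principal_eigenvalue \<Omega> a - principal_eigenvalue \<Omega> b\<bar> \<le> (K + 1) * ?\<delta>" .
  qed
qed

theorem proposition2p2:
  fixes \<Omega> :: "(real ^ 'n) set" and \<mu>\<^sub>0 \<mu>\<^sub>1 :: real
  assumes "bounded_lipschitz_domain \<Omega>"
    and "0 < \<mu>\<^sub>0" and "\<mu>\<^sub>0 \<le> \<mu>\<^sub>1"
  shows "(\<forall>a \<in> coefficients \<Omega> \<mu>\<^sub>0 \<mu>\<^sub>1. \<forall>b \<in> coefficients \<Omega> \<mu>\<^sub>0 \<mu>\<^sub>1. \<forall>t \<in> {0..1}.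
            (\<lambda>x. (1 - t) *\<^sub>R a x + t *\<^sub>R b x) \<in> coefficients \<Omega> \<mu>\<^sub>0 \<mu>\<^sub>1 \<and>
            principal_eigenvalue \<Omega> (\<lambda>x. (1 - t) *\<^sub>R a x + t *\<^sub>R b x)
              \<ge> (1 - t) * principal_eigenvalue \<Omega> a + t * principal_eigenvalue \<Omega> b) \<and>
         (\<exists>L > 0. \<forall>a \<in> coefficients \<Omega> \<mu>\<^sub>0 \<mu>\<^sub>1. \<forall>b \<in> coefficients \<Omega> \<mu>\<^sub>0 \<mu>\<^sub>1.
            \<bar>principal_eigenvalue \<Omega> a - principal_eigenvalue \<Omega> b\<bar>
              \<le> L * Linf_norm \<Omega> (\<lambda>x. a x - b x))"
proof (intro conjI ballI)
  fix a b and t :: real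
  assume a: "a \<in> coefficients \<Omega> \<mu>\<^sub>0 \<mu>\<^sub>1" and b: "b \<in> coefficients \<Omega> \<mu>\<^sub>0 \<mu>\<^sub>1" and t: "t \<in> {0..1}"
  show "(\<lambda>x. (1 - t) *\<^sub>R a x + t *\<^sub>R b x) \<in> coefficients \<Omega> \<mu>\<^sub>0 \<mu>\<^sub>1"
    using a b t by (rule coefficients_convex)
  show "principal_eigenvalue \<Omega> (\<lambda>x. (1 - t) *\<^sub>R a x + t *\<^sub>R b x)
      \<ge> (1 - t) * principal_eigenvalue \<Omega> a + t * principal_eigenvalue \<Omega> b"
    using a b less_imp_le[OF \<open>0 < \<mu>\<^sub>0\<close>] t by (rule principal_eigenvalue_concave)
qed (rule principal_eigenvalue_Lipschitz[OF \<open>0 < \<mu>\<^sub>0\<close> \<open>\<mu>\<^sub>0 \<le> \<mu>\<^sub>1\<close>])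

end
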